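(* For each of the two problems MCFOD and $r$MCFOD defined in the context, there is an optimal solution $(R^*,a,p,q)$ in which the outsourcing fees satisfy $$p^r_i\in P^r_i:=\{\overline c^{\,rk}_{o(r)i}:k\in K\}\cup\{0\}\quad\text{for all } i\in H \text{ and } r\in R \text{ with } o(r)\notin H,$$ $$q^r_i\in Q^r_i:=\{\overline c^{\,rk}_{id(r)}:k\in K\}\cup\{0\}\quad\text{for all } i\in H \text{ and } r\in R \text{ with } d(r)\notin H.$$
   Context: Data. $V$ is a finite node set, $\emptyset\ne H\subset V$ the set of hubs, $K$ a finite nonempty set of carriers (with $0\notin K$), $R$ a finite set of commodities. Each $r\in R$ has an origin $o(r)\in V$, a destination $d(r)\in V$, not both in $H$, and a revenue $b^r>0$. For $r\in R$ and $i,j\in H$ (possibly $i=j$), $c^r_{ij}>0$ is the leader's interhub routing cost (for each $r$ it satisfies the triangle inequality). For $k\in K$, $i\in H$: $\overline c^{\,rk}_{o(r)i}>0$ (if $o(r)\notin H$) and $\overline c^{\,rk}_{id(r)}>0$ (if $d(r)\notin H$) are the reservation prices of carrier $k$ for the first leg of $r$ (from $o(r)$ to hub $i$) and the third leg of $r$ (from hub $i$ to $d(r)$). Leader's decisions. A subset $R^*\subseteq R$ of served commodities; an allocation $a:V\setminus H\to K\cup\{0\}$ ($a(i)=0$ means $i$ is not allocated); outsourcing fees $p^r_i\ge0$ for $i\in H$, $o(r)\notin H$, and $q^r_i\ge0$ for $i\in H$, $d(r)\notin H$. Profit-maximizing carriers. $I_k(r,p)=\arg\max_{i\in H}\{p^r_i-\overline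 c^{\,rk}_{o(r)i}\}$ if this maximum is $\ge0$ and $I_k(r,p)=\emptyset$ otherwise; $J_k(r,q)=\arg\max_{i\in H}\{q^r_i-\overline c^{\,rk}_{id(r)}\}$ if this maximum is $\ge0$ and $J_k(r,q)=\emptyset$ otherwise. Reservation-price-oriented carriers. $rI_k(r,p)=\{i\in H:p^r_i-\overline c^{\,rk}_{o(r)i}\ge0\}$, $rJ_k(r,q)=\{i\in H:q^r_i-\overline c^{\,rk}_{id(r)}\ge0\}$. For $k=0$ all these sets are empty. Routing cost. $C_r(a,p,q)$ equals $\min\{p^r_i+c^r_{ij}+q^r_j:i\in I_{a(o(r))}(r,p),\,j\in J_{a(d(r))}(r,q)\}$ if $o(r),d(r)\notin H$; $\min\{p^r_i+c^r_{id(r)}:i\in I_{a(o(r))}(r,p)\}$ if $o(r)\notin H$, $d(r)\in H$; $\min\{c^r_{o(r)j}+q^r_j:j\in J_{a(d(r))}(r,q)\}$ if $o(r)\in H$, $d(r)\notin H$; where the minimum over an empty set is $+\infty$. $rC_r(a,p,q)$ is defined in the same way with $rI,rJ$ in place of $I,J$. MCFOD: maximize $\sum_{r\in R^*}[b^r-C_r(a,p,q)]$ over $(R^*,a,p,q)$. $r$MCFOD: maximize $\sum_{r\in R^*}[b^r-rC_r(a,p,q)]$ over $(R^*,a,p,q)$. *)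

theory Defs
  imports Complex_Main "HOL-Library.Extended_Real"
begin

text \<open>
  The reservation prices form one array \<open>rprice D r k u v\<close> indexed by arcs \<open>(u, v)\<close>. Only the
  arcs \<open>(orig D r, i)\<close> with \<open>orig D r \<notin> hubs D\<close> and \<open>(i, dest D r)\<close> with \<open>dest D r \<notin> hubs D\<close>,
  for a hub \<open>i\<close>, are used; the two kinds are disjoint.
\<close>

record ('v, 'k, 'r) fod =
  nodes :: "'v set"
  hubs :: "'v set"
  carriers :: "'k set"
  commodities :: "'r set"
  orig :: "'r \<Rightarrow> 'v"
  dest :: "'r \<Rightarrow> 'v"
  revenue :: "'r \<Rightarrow> real"
  hcost :: "'r \<Rightarrow> 'v \<Rightarrow> 'v \<Rightarrow> real"
  rprice :: "'r \<Rightarrow> 'k \<Rightarrow> 'v \<Rightarrow> 'v \<Rightarrow> real"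

definition valid_fod :: "('v, 'k, 'r) fod \<Rightarrow> bool" where
  "valid_fod D \<longleftrightarrow>
     finite (nodes D) \<and> hubs D \<noteq> {} \<and> hubs D \<subseteq> nodes D \<and>
     finite (carriers D) \<and> carriers D \<noteq> {} \<and>
     finite (commodities D) \<and>
     (\<forall>r\<in>commodities D.
        orig D r \<in> nodes D \<and> dest D r \<in> nodes D \<and>
        \<not> (orig D r \<in> hubs D \<and> dest D r \<in> hubs D) \<and>
        revenue D r > 0 \<and>
        (\<forall>i\<in>hubs D. \<forall>j\<in>hubs D. hcost D r i j > 0) \<and>
        (\<forall>i\<in>hubs D. \<forall>j\<in>hubs D. \<forall>l\<in>hubs D. hcost D r i j \<le> hcost D r i l + hcost D r l j) \<and>
        (\<forall>k\<in>carriers D. \<forall>i\<in>hubs D.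
           (orig D r \<notin> hubs D \<longrightarrow> rprice D r k (orig D r) i > 0) \<and>
           (dest D r \<notin> hubs D \<longrightarrow> rprice D r k i (dest D r) > 0)))"

text \<open>
  A solution is a tuple \<open>(S, a, p, q)\<close>: served commodities, allocation, first-leg fees,
  third-leg fees. The value \<open>None\<close> of the allocation plays the role of the dummy carrier 0.
  Values of \<open>a\<close>, \<open>p\<close>, \<open>q\<close> outside the index ranges below are irrelevant.
\<close>

type_synonym ('v, 'k, 'r) solution =
  "'r set \<times> ('v \<Rightarrow> 'k option) \<times> ('r \<Rightarrow> 'v \<Rightarrow> real) \<times> ('r \<Rightarrow> 'v \<Rightarrow> real)"

definition feasible :: "('v, 'k, 'r) fod \<Rightarrow> ('v, 'k, 'r) solution \<Rightarrow> bool" where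
  "feasible D = (\<lambda>(S, a, p, q).
     S \<subseteq> commodities D \<and>
     (\<forall>v\<in>nodes D - hubs D. a v \<in> insert None (Some ` carriers D)) \<and>
     (\<forall>r\<in>commodities D. \<forall>i\<in>hubs D.
        (orig D r \<notin> hubs D \<longrightarrow> p r i \<ge> 0) \<and>
        (dest D r \<notin> hubs D \<longrightarrow> q r i \<ge> 0)))"

definition profit_max_hubs :: "'v set \<Rightarrow> ('v \<Rightarrow> real) \<Rightarrow> 'v set" where
  "profit_max_hubs H g =
     (if Max (g ` H) \<ge> 0 then {i. is_arg_max g (\<lambda>i. i \<in> H) i} else {})"

definition acceptable_hubs :: "'v set \<Rightarrow> ('v \<Rightarrow> real) \<Rightarrow> 'v set" where
  "acceptable_hubs H g = {i \<in> H. g i \<ge> 0}"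

fun I_set :: "('v, 'k, 'r) fod \<Rightarrow> 'k option \<Rightarrow> 'r \<Rightarrow> ('r \<Rightarrow> 'v \<Rightarrow> real) \<Rightarrow> 'v set" where
  "I_set D None r p = {}"
| "I_set D (Some k) r p = profit_max_hubs (hubs D) (\<lambda>i. p r i - rprice D r k (orig D r) i)"

fun J_set :: "('v, 'k, 'r) fod \<Rightarrow> 'k option \<Rightarrow> 'r \<Rightarrow> ('r \<Rightarrow> 'v \<Rightarrow> real) \<Rightarrow> 'v set" where
  "J_set D None r q = {}"
| "J_set D (Some k) r q = profit_max_hubs (hubs D) (\<lambda>i. q r i - rprice D r k i (dest D r))"

fun rI_set :: "('v, 'k, 'r) fod \<Rightarrow> 'k option \<Rightarrow> 'r \<Rightarrow> ('r \<Rightarrow> 'v \<Rightarrow> real) \<Rightarrow> 'v set" where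
  "rI_set D None r p = {}"
| "rI_set D (Some k) r p = acceptable_hubs (hubs D) (\<lambda>i. p r i - rprice D r k (orig D r) i)"

fun rJ_set :: "('v, 'k, 'r) fod \<Rightarrow> 'k option \<Rightarrow> 'r \<Rightarrow> ('r \<Rightarrow> 'v \<Rightarrow> real) \<Rightarrow> 'v set" where
  "rJ_set D None r q = {}"
| "rJ_set D (Some k) r q = acceptable_hubs (hubs D) (\<lambda>i. q r i - rprice D r k i (dest D r))"

text \<open>
  Routing cost of \<open>r\<close> when the carriers are willing to use the hubs \<open>I\<close> on the first and \<open>J\<close> on
  the third leg. The sets are finite, so each infimum is a minimum, or \<open>\<infinity>\<close> over the empty set.
  The last case is \<open>orig D r \<in> hubs D\<close>, \<open>dest D r \<notin> hubs D\<close>.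
\<close>

definition route_cost ::
    "('v, 'k, 'r) fod \<Rightarrow> 'v set \<Rightarrow> 'v set \<Rightarrow> ('r \<Rightarrow> 'v \<Rightarrow> real) \<Rightarrow> ('r \<Rightarrow> 'v \<Rightarrow> real) \<Rightarrow> 'r \<Rightarrow> ereal" where
  "route_cost D I J p q r =
     (if orig D r \<notin> hubs D \<and> dest D r \<notin> hubs D
        then (INF (i, j)\<in>I \<times> J. ereal (p r i + hcost D r i j + q r j))
      else if orig D r \<notin> hubs D
        then (INF i\<in>I. ereal (p r i + hcost D r i (dest D r)))
      else (INF j\<in>J. ereal (hcost D r (orig D r) j + q r j)))"

definition C_cost ::
    "('v, 'k, 'r) fod \<Rightarrow> ('v \<Rightarrow> 'k option) \<Rightarrow> ('r \<Rightarrow> 'v \<Rightarrow> real) \<Rightarrow> ('r \<Rightarrow> 'v \<Rightarrow> real) \<Rightarrow> 'r \<Rightarrow> ereal" where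
  "C_cost D a p q r =
     route_cost D (I_set D (a (orig D r)) r p) (J_set D (a (dest D r)) r q) p q r"

definition rC_cost ::
    "('v, 'k, 'r) fod \<Rightarrow> ('v \<Rightarrow> 'k option) \<Rightarrow> ('r \<Rightarrow> 'v \<Rightarrow> real) \<Rightarrow> ('r \<Rightarrow> 'v \<Rightarrow> real) \<Rightarrow> 'r \<Rightarrow> ereal" where
  "rC_cost D a p q r =
     route_cost D (rI_set D (a (orig D r)) r p) (rJ_set D (a (dest D r)) r q) p q r"

definition MCFOD_profit :: "('v, 'k, 'r) fod \<Rightarrow> ('v, 'k, 'r) solution \<Rightarrow> ereal" where
  "MCFOD_profit D = (\<lambda>(S, a, p, q). \<Sum>r\<in>S. ereal (revenue D r) - C_cost D a p q r)"

definition rMCFOD_profit :: "('v, 'k, 'r) fod \<Rightarrow> ('v, 'k, 'r) solution \<Rightarrow> ereal" where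
  "rMCFOD_profit D = (\<lambda>(S, a, p, q). \<Sum>r\<in>S. ereal (revenue D r) - rC_cost D a p q r)"

definition MCFOD_optimal :: "('v, 'k, 'r) fod \<Rightarrow> ('v, 'k, 'r) solution \<Rightarrow> bool" where
  "MCFOD_optimal D = is_arg_max (MCFOD_profit D) (feasible D)"

definition rMCFOD_optimal :: "('v, 'k, 'r) fod \<Rightarrow> ('v, 'k, 'r) solution \<Rightarrow> bool" where
  "rMCFOD_optimal D = is_arg_max (rMCFOD_profit D) (feasible D)"

definition P_set :: "('v, 'k, 'r) fod \<Rightarrow> 'r \<Rightarrow> 'v \<Rightarrow> real set" where
  "P_set D r i = {rprice D r k (orig D r) i | k. k \<in> carriers D} \<union> {0}"

definition Q_set :: "('v, 'k, 'r) fod \<Rightarrow> 'r \<Rightarrow> 'v \<Rightarrow> real set" where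
  "Q_set D r i = {rprice D r k i (dest D r) | k. k \<in> carriers D} \<union> {0}"

end

theory Submission imports Defs "HOL-Library.FuncSet" begin

text \<open>
  If a commodity is routed through hub \<open>s\<close> on a leg operated by carrier \<open>k\<close>, lower the fee at \<open>s\<close>
  to the reservation price of \<open>k\<close> and all other fees on that leg to \<open>0\<close>. Since reservation prices
  are positive, \<open>s\<close> then is the only hub that \<open>k\<close> is willing to use, under either behaviour of the
  carriers, and the routing cost does not increase. So every solution is dominated by one that is
  determined by the served commodities, the allocation and one hub per commodity and leg, and there
  are finitely many of these.
\<close>

lemma finite_INF_attained:
  fixes f :: "'a \<Rightarrow> 'b::complete_linorder"
  assumes "finite A" "A \<noteq> {}"
  obtains x where "x \<in> A" "f x = (INF x\<in>A. f x)"
proof -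
  have "Inf (f ` A) \<in> f ` A"
    using assms Min_in[of "f ` A"] Min_Inf[of "f ` A"] by simp
  then show ?thesis
    using that by (metis imageE)
qed

text \<open>The branch \<open>None\<close> only needs a default, since an unallocated node has no
  willing hub at any fee; 0 is chosen because it belongs to both price sets.\<close>

definition single_fee :: "('k \<Rightarrow> 'v \<Rightarrow> real) \<Rightarrow> 'k option \<Rightarrow> 'v \<Rightarrow> 'v \<Rightarrow> real" where
  "single_fee c ko s i = (if i = s then (case ko of None \<Rightarrow> 0 | Some k \<Rightarrow> c k i) else 0)"

text \<open>
  A rule \<open>F\<close> for the carriers' behaviour selects hubs from the carrier's gain at each hub. The
  axioms are the only properties that the two behaviours need to share.
\<close>

locale fod_rule =
  fixes D :: "('v, 'k, 'r) fod" and F :: "'v set \<Rightarrow> ('v \<Rightarrow> real) \<Rightarrow> 'v set"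
  assumes valid: "valid_fod D"
    and rule_acceptable: "i \<in> F (hubs D) g \<Longrightarrow> i \<in> hubs D \<and> 0 \<le> g i"
    and rule_single: "\<lbrakk>s \<in> hubs D; g s = 0; \<And>i. i \<in> hubs D \<Longrightarrow> i \<noteq> s \<Longrightarrow> g i < 0\<rbrakk>
      \<Longrightarrow> F (hubs D) g = {s}"
begin

section \<open>Routing cost under a general rule, and fee reduction for one commodity\<close>

definition willing :: "('k \<Rightarrow> 'v \<Rightarrow> real) \<Rightarrow> 'k option \<Rightarrow> ('v \<Rightarrow> real) \<Rightarrow> 'v set" where
  "willing c ko p = (case ko of None \<Rightarrow> {} | Some k \<Rightarrow> F (hubs D) (\<lambda>i. p i - c k i))"

abbreviation first_price :: "'r \<Rightarrow> 'k \<Rightarrow> 'v \<Rightarrow> real" where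
  "first_price r k i \<equiv> rprice D r k (orig D r) i"

abbreviation third_price :: "'r \<Rightarrow> 'k \<Rightarrow> 'v \<Rightarrow> real" where
  "third_price r k i \<equiv> rprice D r k i (dest D r)"

definition cost :: "('v \<Rightarrow> 'k option) \<Rightarrow> ('r \<Rightarrow> 'v \<Rightarrow> real) \<Rightarrow> ('r \<Rightarrow> 'v \<Rightarrow> real) \<Rightarrow> 'r \<Rightarrow> ereal" where
  "cost a p q r = route_cost D (willing (first_price r) (a (orig D r)) (p r))
     (willing (third_price r) (a (dest D r)) (q r)) p q r"

definition profit :: "('v, 'k, 'r) solution \<Rightarrow> ereal" where
  "profit = (\<lambda>(S, a, p, q). \<Sum>r\<in>S. ereal (revenue D r) - cost a p q r)"

lemma finite_hubs: "finite (hubs D)"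
  using valid by (auto simp: valid_fod_def intro: finite_subset)

lemma finite_willing: "finite (willing c ko p)"
  using finite_hubs rule_acceptable
  by (auto simp: willing_def split: option.split intro: finite_subset)

text \<open>Acceptability of \<open>i\<close> gives \<open>c k i\<close> \<le> \<open>p i\<close>,
  hence the last claim. Positivity is asked only for the carrier in \<open>ko\<close> and for hubs,
  as \<open>valid_fod\<close> says nothing about other prices.\<close>

lemma willing_single_fee:
  assumes "i \<in> willing c ko p" "\<And>k j. ko = Some k \<Longrightarrow> j \<in> hubs D \<Longrightarrow> 0 < c k j"
  shows "i \<in> hubs D" "willing c ko (single_fee c ko i) = {i}" "single_fee c ko i i \<le> p i"
proof -
  obtain k where k: "ko = Some k" "i \<in> F (hubs D) (\<lambda>i. p i - c k i)"
    using assms(1) by (auto simp: willing_def split: option.splits)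
  show i: "i \<in> hubs D" and "single_fee c ko i i \<le> p i"
    using rule_acceptable[OF k(2)] k(1) by (auto simp: single_fee_def)
  \<comment> \<open>At the new fees the gain of \<open>k\<close> is exactly 0 at \<open>i\<close>
    and \<open>- c k j\<close> < 0 at every other hub \<open>j\<close>, which is the situation of
    \<open>rule_single\<close>.\<close>
  show "willing c ko (single_fee c ko i) = {i}"
    unfolding willing_def k(1) option.case
    by (rule rule_single) (use i k(1) assms(2) in \<open>auto simp: single_fee_def\<close>)
qed

text \<open>The cost of \<open>r\<close> depends on the fees only through their rows at
  \<open>r\<close>. Quantifying over all \<open>p'\<close>, \<open>q'\<close> with the prescribed
  row lets the choices for different commodities be glued together later. Likewise only the
  allocation at non-hub endpoints matters, so \<open>a'\<close> may differ from \<open>a\<close>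
  elsewhere.\<close>

lemma cost_single_fee_le:
  assumes r: "r \<in> commodities D"
    and a: "\<And>v k. v \<in> nodes D - hubs D \<Longrightarrow> a v = Some k \<Longrightarrow> k \<in> carriers D"
    and a': "\<And>v. v \<in> nodes D - hubs D \<Longrightarrow> a' v = a v"
  shows "\<exists>s\<in>hubs D. \<exists>t\<in>hubs D. \<forall>p' q'.
    p' r = single_fee (first_price r) (a' (orig D r)) s \<longrightarrow>
    q' r = single_fee (third_price r) (a' (dest D r)) t \<longrightarrow> cost a' p' q' r \<le> cost a p q r"
proof -
  let ?I = "willing (first_price r) (a (orig D r)) (p r)"
  let ?J = "willing (third_price r) (a (dest D r)) (q r)"
  \<comment> \<open>An arbitrary hub, used where the choice is immaterial: for a leg that does not
    exist, or when the old cost is already infinite.\<close>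
  obtain h where h: "h \<in> hubs D"
    using valid by (auto simp: valid_fod_def)
  have nodes: "orig D r \<in> nodes D" "dest D r \<in> nodes D"
    and legs: "orig D r \<notin> hubs D \<or> dest D r \<notin> hubs D"
    using valid r by (auto simp: valid_fod_def)
  have I: "i \<in> hubs D"
      "willing (first_price r) (a (orig D r)) (single_fee (first_price r) (a (orig D r)) i) = {i}"
      "single_fee (first_price r) (a (orig D r)) i i \<le> p r i"
    if "orig D r \<notin> hubs D" "i \<in> ?I" for i
    using willing_single_fee[OF that(2)] that(1) valid r a nodes by (auto simp: valid_fod_def)
  have J: "j \<in> hubs D"
      "willing (third_price r) (a (dest D r)) (single_fee (third_price r) (a (dest D r)) j) = {j}"
      "single_fee (third_price r) (a (dest D r)) j j \<le> q r j"
    if "dest D r \<notin> hubs D" "j \<in> ?J" for j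
    using willing_single_fee[OF that(2)] that(1) valid r a nodes by (auto simp: valid_fod_def)
  consider (both) "orig D r \<notin> hubs D" "dest D r \<notin> hubs D"
    | (first) "orig D r \<notin> hubs D" "dest D r \<in> hubs D"
    | (third) "orig D r \<in> hubs D" "dest D r \<notin> hubs D"
    using legs by blast
  then show ?thesis
  proof cases
    case both
    show ?thesis
    proof (cases "?I \<times> ?J = {}")
      case True
      then have "cost a p q r = \<infinity>"
        using both by (simp only: cost_def route_cost_def) (simp add: top_ereal_def)
      then show ?thesis using h by auto
    next
      case False
      then obtain x where x: "x \<in> ?I \<times> ?J"
        "(\<lambda>(i, j). ereal (p r i + hcost D r i j + q r j)) x
          = (INF (i, j)\<in>?I \<times> ?J. ereal (p r i + hcost D r i j + q r j))"
        by (rule finite_INF_attained[OF finite_cartesian_product[OF finite_willing finite_willing]])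
      obtain i j where ij: "i \<in> ?I" "j \<in> ?J"
        "cost a p q r = ereal (p r i + hcost D r i j + q r j)"
        using x both by (cases x) (auto simp: cost_def route_cost_def)
      \<comment> \<open>Both willing sets shrink to singletons, so the new cost is the single term
        at \<open>(i, j)\<close>: the same interhub cost with fees that are no larger.\<close>
      show ?thesis
        using I[OF both(1) ij(1)] J[OF both(2) ij(2)] both nodes a' ij(3)
        by (intro bexI[of _ i] bexI[of _ j]) (auto simp: cost_def route_cost_def)
    qed
  next
    case first
    show ?thesis
    proof (cases "?I = {}")
      case True
      then have "cost a p q r = \<infinity>"
        using first by (simp add: cost_def route_cost_def top_ereal_def)
      then show ?thesis using h by auto
    next
      case False
      then obtain i where i: "i \<in> ?I" "ereal (p r i + hcost D r i (dest D r))
          = (INF i\<in>?I. ereal (p r i + hcost D r i (dest D r)))"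
        by (rule finite_INF_attained[OF finite_willing])
      then have "cost a p q r = ereal (p r i + hcost D r i (dest D r))"
        using first by (simp add: cost_def route_cost_def)
      then show ?thesis
        using I[OF first(1) i(1)] first nodes a' h
        by (intro bexI[of _ i] bexI[of _ h]) (auto simp: cost_def route_cost_def)
    qed
  next
    case third
    show ?thesis
    proof (cases "?J = {}")
      case True
      then have "cost a p q r = \<infinity>"
        using third by (simp add: cost_def route_cost_def top_ereal_def)
      then show ?thesis using h by auto
    next
      case False
      then obtain j where j: "j \<in> ?J" "ereal (hcost D r (orig D r) j + q r j)
          = (INF j\<in>?J. ereal (hcost D r (orig D r) j + q r j))"
        by (rule finite_INF_attained[OF finite_willing])
      then have "cost a p q r = ereal (hcost D r (orig D r) j + q r j)"
        using third by (simp add: cost_def route_cost_def)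
      then show ?thesis
        using J[OF third(2) j(1)] third nodes a' h
        by (intro bexI[of _ h] bexI[of _ j]) (auto simp: cost_def route_cost_def)
    qed
  qed
qed

section \<open>The finite family of dominating solutions\<close>

definition single_fee_solution ::
    "'r set \<times> ('v \<Rightarrow> 'k option) \<times> ('r \<Rightarrow> 'v) \<times> ('r \<Rightarrow> 'v) \<Rightarrow> ('v, 'k, 'r) solution" where
  "single_fee_solution = (\<lambda>(S, a, s, t). (S, a,
     \<lambda>r. single_fee (first_price r) (a (orig D r)) (s r),
     \<lambda>r. single_fee (third_price r) (a (dest D r)) (t r)))"

text \<open>Extensional function spaces fix the irrelevant values outside the index sets, which
  makes the family finite even over infinite types.\<close>

definition hub_plans :: "('r set \<times> ('v \<Rightarrow> 'k option) \<times> ('r \<Rightarrow> 'v) \<times> ('r \<Rightarrow> 'v)) set" where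
  "hub_plans = Pow (commodities D) \<times>
     (nodes D - hubs D \<rightarrow>\<^sub>E insert None (Some ` carriers D)) \<times>
     (commodities D \<rightarrow>\<^sub>E hubs D) \<times> (commodities D \<rightarrow>\<^sub>E hubs D)"

lemma finite_hub_plans: "finite hub_plans"
  using valid finite_hubs unfolding hub_plans_def
  by (intro finite_cartesian_product finite_PiE) (auto simp: valid_fod_def)

lemma hub_plans_nonempty: "hub_plans \<noteq> {}"
  using valid by (auto simp: hub_plans_def valid_fod_def PiE_eq_empty_iff)

lemma single_fee_solution_dominates:
  assumes "feasible D x"
  shows "\<exists>y\<in>hub_plans. profit x \<le> profit (single_fee_solution y)"
proof -
  obtain S a p q where x: "x = (S, a, p, q)" by (cases x)
  \<comment> \<open>Restriction makes the allocation extensional, as \<open>hub_plans\<close>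
    demands, without changing it at non-hub nodes.\<close>
  define a' where "a' = restrict a (nodes D - hubs D)"
  have S: "S \<subseteq> commodities D"
    and a: "\<And>v. v \<in> nodes D - hubs D \<Longrightarrow> a v \<in> insert None (Some ` carriers D)"
    using assms by (auto simp: x feasible_def)
  have "\<forall>r\<in>commodities D. \<exists>s t. s \<in> hubs D \<and> t \<in> hubs D \<and> (\<forall>p' q'.
      p' r = single_fee (first_price r) (a' (orig D r)) s \<longrightarrow>
      q' r = single_fee (third_price r) (a' (dest D r)) t \<longrightarrow> cost a' p' q' r \<le> cost a p q r)"
  proof
    fix r assume "r \<in> commodities D"
    moreover have "k \<in> carriers D" if "v \<in> nodes D - hubs D" "a v = Some k" for v k
      using a[OF that(1)] that(2) by auto
    moreover have "a' v = a v" if "v \<in> nodes D - hubs D" for v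
      using that by (simp add: a'_def)
    ultimately have "\<exists>s\<in>hubs D. \<exists>t\<in>hubs D. \<forall>p' q'.
      p' r = single_fee (first_price r) (a' (orig D r)) s \<longrightarrow>
      q' r = single_fee (third_price r) (a' (dest D r)) t \<longrightarrow> cost a' p' q' r \<le> cost a p q r"
      by (rule cost_single_fee_le)
    then show "\<exists>s t. s \<in> hubs D \<and> t \<in> hubs D \<and> (\<forall>p' q'.
      p' r = single_fee (first_price r) (a' (orig D r)) s \<longrightarrow>
      q' r = single_fee (third_price r) (a' (dest D r)) t \<longrightarrow> cost a' p' q' r \<le> cost a p q r)"
      by blast
  qed
  then obtain s t where st: "\<And>r. r \<in> commodities D \<Longrightarrow> s r \<in> hubs D \<and> t r \<in> hubs D \<and> (\<forall>p' q'.
      p' r = single_fee (first_price r) (a' (orig D r)) (s r) \<longrightarrow>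
      q' r = single_fee (third_price r) (a' (dest D r)) (t r) \<longrightarrow> cost a' p' q' r \<le> cost a p q r)"
    by metis
  let ?y = "(S, a', restrict s (commodities D), restrict t (commodities D))"
  have "?y \<in> hub_plans"
    using S a st by (auto simp: hub_plans_def a'_def)
  \<comment> \<open>The served set is kept, so the profits compare term by term; \<open>st\<close>
    is instantiated with the glued fee functions.\<close>
  moreover have "profit x \<le> profit (single_fee_solution ?y)"
    unfolding profit_def single_fee_solution_def x prod.case
    using S st by (intro sum_mono ereal_minus_mono) auto
  ultimately show ?thesis by blast
qed

text \<open>The element 0 of the price sets covers the hubs other than \<open>s\<close> and the
  unallocated case.\<close>

lemma single_fee_in_prices:
  assumes "ko \<in> insert None (Some ` carriers D)"
  shows "single_fee c ko s i \<in> {c k i | k. k \<in> carriers D} \<union> {0}"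
  using assms by (auto simp: single_fee_def)

lemma single_fee_solution_fees:
  assumes "y \<in> hub_plans" "single_fee_solution y = (S, a, p, q)" "r \<in> commodities D"
  shows "orig D r \<notin> hubs D \<Longrightarrow> p r i \<in> P_set D r i"
    and "dest D r \<notin> hubs D \<Longrightarrow> q r i \<in> Q_set D r i"
proof -
  obtain s t where y: "y = (S, a, s, t)"
    and p: "p r = single_fee (first_price r) (a (orig D r)) (s r)"
    and q: "q r = single_fee (third_price r) (a (dest D r)) (t r)"
    using assms(2) by (cases y) (auto simp: single_fee_solution_def)
  have a: "a v \<in> insert None (Some ` carriers D)" if "v \<in> nodes D - hubs D" for v
    using assms(1) that unfolding y hub_plans_def by blast
  have nodes: "orig D r \<in> nodes D" "dest D r \<in> nodes D"
    using valid assms(3) by (auto simp: valid_fod_def)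
  show "p r i \<in> P_set D r i" if "orig D r \<notin> hubs D"
    unfolding p P_set_def
    using single_fee_in_prices[OF a, of "orig D r" "first_price r"] that nodes by simp
  show "q r i \<in> Q_set D r i" if "dest D r \<notin> hubs D"
    unfolding q Q_set_def
    using single_fee_in_prices[OF a, of "dest D r" "third_price r"] that nodes by simp
qed

text \<open>Nonnegativity of the fees comes from their membership in the price sets, whose elements
  at hubs are positive prices or 0.\<close>

lemma single_fee_solution_feasible:
  assumes "y \<in> hub_plans"
  shows "feasible D (single_fee_solution y)"
proof -
  obtain S a p q where eq: "single_fee_solution y = (S, a, p, q)"
    by (cases "single_fee_solution y")
  have "S \<subseteq> commodities D" and a: "a \<in> nodes D - hubs D \<rightarrow> insert None (Some ` carriers D)"
    using assms eq by (auto simp: hub_plans_def single_fee_solution_def)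
  moreover have "0 \<le> p r i" if "r \<in> commodities D" "i \<in> hubs D" "orig D r \<notin> hubs D" for r i
    using single_fee_solution_fees(1)[OF assms eq that(1,3), of i] that valid
    by (auto simp: P_set_def valid_fod_def intro: less_imp_le)
  moreover have "0 \<le> q r i" if "r \<in> commodities D" "i \<in> hubs D" "dest D r \<notin> hubs D" for r i
    using single_fee_solution_fees(2)[OF assms eq that(1,3), of i] that valid
    by (auto simp: Q_set_def valid_fod_def intro: less_imp_le)
  ultimately show ?thesis
    unfolding eq feasible_def by blast
qed

text \<open>A best member of the finite family exists and beats every feasible solution by
  domination. Being feasible itself, it is a global optimum, so existence needs no compactness of
  the fee space.\<close>

theorem optimal_with_reservation_fees:
  "\<exists>S a p q. is_arg_max profit (feasible D) (S, a, p, q) \<and>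
     (\<forall>i\<in>hubs D. \<forall>r\<in>commodities D. orig D r \<notin> hubs D \<longrightarrow> p r i \<in> P_set D r i) \<and>
     (\<forall>i\<in>hubs D. \<forall>r\<in>commodities D. dest D r \<notin> hubs D \<longrightarrow> q r i \<in> Q_set D r i)"
proof -
  let ?f = "\<lambda>y. profit (single_fee_solution y)"
  have "Max (?f ` hub_plans) \<in> ?f ` hub_plans"
    using finite_hub_plans hub_plans_nonempty by (intro Max_in) auto
  then obtain y where y: "y \<in> hub_plans" "?f y = Max (?f ` hub_plans)"
    by auto
  have "profit x \<le> ?f y" if x: "feasible D x" for x
  proof -
    obtain z where z: "z \<in> hub_plans" "profit x \<le> ?f z"
      using single_fee_solution_dominates[OF x] by blast
    note z(2)
    also have "?f z \<le> ?f y"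
      using z(1) finite_hub_plans unfolding y(2) by simp
    finally show ?thesis .
  qed
  \<comment> \<open>\<open>is_arg_max\<close> forbids a strictly better feasible solution; in the
    linear order of \<open>ereal\<close> this is the bound just shown.\<close>
  then have opt: "is_arg_max profit (feasible D) (single_fee_solution y)"
    using single_fee_solution_feasible[OF y(1)] by (auto simp: is_arg_max_def not_less)
  obtain S a p q where eq: "single_fee_solution y = (S, a, p, q)"
    by (cases "single_fee_solution y")
  show ?thesis
    using opt single_fee_solution_fees[OF y(1) eq] unfolding eq by blast
qed

end

section \<open>The two carrier behaviours as instances of the rule\<close>

lemma fod_rule_profit_max_hubs:
  assumes "valid_fod D"
  shows "fod_rule D profit_max_hubs"
proof
  have fin: "finite (hubs D)" "hubs D \<noteq> {}"
    using assms by (auto simp: valid_fod_def intro: finite_subset)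
  show "i \<in> hubs D \<and> 0 \<le> g i" if i: "i \<in> profit_max_hubs (hubs D) g" for i g
  proof -
    have "0 \<le> Max (g ` hubs D)" "i \<in> hubs D" "\<forall>j\<in>hubs D. g j \<le> g i"
      using i by (auto simp: profit_max_hubs_def is_arg_max_def not_less split: if_splits)
    moreover have "Max (g ` hubs D) \<in> g ` hubs D"
      using fin by (intro Max_in) auto
    \<comment> \<open>\<open>Max\<close> is attained at some hub, whose gain is at most
      \<open>g i\<close>; hence 0 \<le> \<open>g i\<close>.\<close>
    ultimately show ?thesis by fastforce
  qed
  show "profit_max_hubs (hubs D) g = {s}"
    if s: "s \<in> hubs D" "g s = 0" "\<And>i. i \<in> hubs D \<Longrightarrow> i \<noteq> s \<Longrightarrow> g i < 0" for s g
  proof -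
    have "0 \<le> Max (g ` hubs D)"
      using fin s(1,2) by (metis Max_ge finite_imageI imageI)
    \<comment> \<open>A unique hub of gain 0 among negative gains is the only maximizer, and the
      threshold \<open>Max\<close> \<ge> 0 is met with it.\<close>
    moreover have "is_arg_max g (\<lambda>i. i \<in> hubs D) i \<longleftrightarrow> i = s" for i
      using s unfolding is_arg_max_def by (metis less_asym less_irrefl)
    ultimately show ?thesis by (auto simp: profit_max_hubs_def)
  qed
qed (fact assms)

lemma fod_rule_acceptable_hubs:
  assumes "valid_fod D"
  shows "fod_rule D acceptable_hubs"
  using assms by unfold_locales (auto simp: acceptable_hubs_def not_less[symmetric])

theorem mainTheorem2:
  fixes D :: "('v, 'k, 'r) fod"
  assumes "valid_fod D"
  shows "(\<exists>S a p q. MCFOD_optimal D (S, a, p, q) \<and>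
            (\<forall>i\<in>hubs D. \<forall>r\<in>commodities D. orig D r \<notin> hubs D \<longrightarrow> p r i \<in> P_set D r i) \<and>
            (\<forall>i\<in>hubs D. \<forall>r\<in>commodities D. dest D r \<notin> hubs D \<longrightarrow> q r i \<in> Q_set D r i)) \<and>
         (\<exists>S a p q. rMCFOD_optimal D (S, a, p, q) \<and>
            (\<forall>i\<in>hubs D. \<forall>r\<in>commodities D. orig D r \<notin> hubs D \<longrightarrow> p r i \<in> P_set D r i) \<and>
            (\<forall>i\<in>hubs D. \<forall>r\<in>commodities D. dest D r \<notin> hubs D \<longrightarrow> q r i \<in> Q_set D r i))"
proof -
  interpret M: fod_rule D profit_max_hubs
    using assms by (rule fod_rule_profit_max_hubs)
  interpret R: fod_rule D acceptable_hubs
    using assms by (rule fod_rule_acceptable_hubs)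
  \<comment> \<open>Both behaviours are the general \<open>willing\<close> with the respective rule,
    the dummy carrier giving the empty set on either side. The costs and profits therefore agree as
    functions, and optimality transfers directly.\<close>
  have I: "I_set D ko r p = M.willing (M.first_price r) ko (p r)"
    and J: "J_set D ko r q = M.willing (M.third_price r) ko (q r)"
    and rI: "rI_set D ko r p = R.willing (R.first_price r) ko (p r)"
    and rJ: "rJ_set D ko r q = R.willing (R.third_price r) ko (q r)" for ko r p q
    by (cases ko; simp add: M.willing_def R.willing_def)+
  have "MCFOD_profit D = M.profit" "rMCFOD_profit D = R.profit"
    by (simp_all add: MCFOD_profit_def rMCFOD_profit_def M.profit_def R.profit_def
        C_cost_def rC_cost_def M.cost_def R.cost_def I J rI rJ)
  then show ?thesis
    using M.optimal_with_reservation_fees R.optimal_with_reservation_fees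
    by (simp add: MCFOD_optimal_def rMCFOD_optimal_def)
qed

end
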